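(* Let $G$ be a finite chordal graph (connected) and $\ell\ge 0$. Then $c'_\ell(G)=c_\ell(G)$. Furthermore, in the $\ell$-visibility game on $G$, once some cop is within distance $\ell$ of the robber, that cop (alone) can capture the robber.
   Context: $\ell$-visibility Cops and Robber on a graph $G$: in round 0 a set of cops each choose a vertex, then a single robber chooses a vertex. In each subsequent round, every cop moves to a neighbouring vertex or stays put, and then the robber moves to a neighbouring vertex or stays put. The robber always knows the positions of all cops. The cops know the robber's position only at moments when some cop and the robber occupy vertices $x,y$ with $d(x,y)\le \ell$ (the cops then see the robber). The cops capture the robber if a cop occupies the robber's vertex. $c_\ell(G)$ is the minimum number of cops that can guarantee capture; $c'_\ell(G)$ is the minimum number of cops that can guarantee that at some moment some cop is within distance $\ell$ of the robber. A graph is chordal if it has no induced cycle of length at least $4$. *)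

theory Defs
  imports "Graph_Theory.Graph_Theory"
begin

text \<open>
  A finite simple graph is a \<^locale>\<open>pair_graph\<close>: its arc relation is finite, symmetric and
  irreflexive, each edge being stored as two opposite arcs.
\<close>

definition within_dist :: "'a pair_pre_digraph \<Rightarrow> nat \<Rightarrow> 'a \<Rightarrow> 'a \<Rightarrow> bool" where
  "within_dist G l x y \<longleftrightarrow> wf_digraph.\<mu> (with_proj G) (\<lambda>_. 1) x y \<le> ereal (real l)"

definition induced_cycle :: "'a pair_pre_digraph \<Rightarrow> 'a list \<Rightarrow> bool" where
  "induced_cycle G vs \<longleftrightarrow>
     3 \<le> length vs \<and> distinct vs \<and> set vs \<subseteq> pverts G \<and>
     (\<forall>i < length vs. \<forall>j < length vs.
        (vs ! i, vs ! j) \<in> parcs G \<longleftrightarrow>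
          j = Suc i mod length vs \<or> i = Suc j mod length vs)"

definition chordal :: "'a pair_pre_digraph \<Rightarrow> bool" where
  "chordal G \<longleftrightarrow> \<not> (\<exists>vs. induced_cycle G vs \<and> 4 \<le> length vs)"

definition legal_move :: "'a pair_pre_digraph \<Rightarrow> 'a \<Rightarrow> 'a \<Rightarrow> bool" where
  "legal_move G u v \<longleftrightarrow> u \<in> pverts G \<and> (v = u \<or> (u, v) \<in> parcs G)"

definition robber_walk :: "'a pair_pre_digraph \<Rightarrow> (nat \<Rightarrow> 'a) \<Rightarrow> bool" where
  "robber_walk G R \<longleftrightarrow> (\<forall>t. legal_move G (R t) (R (Suc t)))"

text \<open>
  The \<open>k\<close> cops are numbered \<open>0, \<dots>, k - 1\<close>; a position of the cops is a function of type
  \<open>nat \<Rightarrow> 'a\<close>, of which only the values below \<open>k\<close> matter.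
\<close>

definition observe :: "'a pair_pre_digraph \<Rightarrow> nat \<Rightarrow> nat \<Rightarrow> (nat \<Rightarrow> 'a) \<Rightarrow> 'a \<Rightarrow> 'a option" where
  "observe G l k c r = (if \<exists>i<k. within_dist G l (c i) r then Some r else None)"

text \<open>
  A strategy \<open>\<sigma>\<close> maps what the cops have observed so far to their next position. They make an
  observation after the robber's move in round \<open>t\<close> (cops at \<open>C t\<close>, robber at \<open>R t\<close>) and another
  one after their own move in round \<open>t + 1\<close> (cops at \<open>C (t + 1)\<close>, robber still at \<open>R t\<close>).
  The list \<open>h\<close> holds the observations made before the play starts from the position \<open>c\<close>;
  \<open>history G l k \<sigma> h c R t\<close> is everything observed up to the robber's move in round \<open>t\<close>.
\<close>

primrec history ::
  "'a pair_pre_digraph \<Rightarrow> nat \<Rightarrow> nat \<Rightarrow> ('a option list \<Rightarrow> nat \<Rightarrow> 'a) \<Rightarrow>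
   'a option list \<Rightarrow> (nat \<Rightarrow> 'a) \<Rightarrow> (nat \<Rightarrow> 'a) \<Rightarrow> nat \<Rightarrow> 'a option list" where
  "history G l k \<sigma> h c R 0 = h @ [observe G l k c (R 0)]"
| "history G l k \<sigma> h c R (Suc t) =
     (let h' = history G l k \<sigma> h c R t; c' = \<sigma> h'
      in h' @ [observe G l k c' (R t), observe G l k c' (R (Suc t))])"

primrec cops_at ::
  "'a pair_pre_digraph \<Rightarrow> nat \<Rightarrow> nat \<Rightarrow> ('a option list \<Rightarrow> nat \<Rightarrow> 'a) \<Rightarrow>
   'a option list \<Rightarrow> (nat \<Rightarrow> 'a) \<Rightarrow> (nat \<Rightarrow> 'a) \<Rightarrow> nat \<Rightarrow> nat \<Rightarrow> 'a" where
  "cops_at G l k \<sigma> h c R 0 = c"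
| "cops_at G l k \<sigma> h c R (Suc t) = \<sigma> (history G l k \<sigma> h c R t)"

text \<open>
  The cops, standing at \<open>c\<close>, can force that at some moment some cop and the robber are related
  by \<open>Q\<close>, whichever vertex of \<open>S\<close> the robber chooses next. The strategy must succeed against every
  sequence of legal robber moves, so it also succeeds against a robber who always knows where the
  cops are.
\<close>

definition can_force ::
  "'a pair_pre_digraph \<Rightarrow> nat \<Rightarrow> nat \<Rightarrow> ('a \<Rightarrow> 'a \<Rightarrow> bool) \<Rightarrow>
   'a option list \<Rightarrow> (nat \<Rightarrow> 'a) \<Rightarrow> 'a set \<Rightarrow> bool" where
  "can_force G l k Q h c S \<longleftrightarrow>
     (\<exists>\<sigma>. \<forall>R. robber_walk G R \<and> R 0 \<in> S \<longrightarrow>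
        (let C = cops_at G l k \<sigma> h c R in
           (\<forall>t. \<forall>i<k. legal_move G (C t i) (C (Suc t) i)) \<and>
           (\<exists>t. \<exists>i<k. Q (C t i) (R t) \<or> Q (C (Suc t) i) (R t))))"

definition can_guarantee :: "'a pair_pre_digraph \<Rightarrow> nat \<Rightarrow> nat \<Rightarrow> ('a \<Rightarrow> 'a \<Rightarrow> bool) \<Rightarrow> bool" where
  "can_guarantee G l k Q \<longleftrightarrow>
     (\<exists>c. (\<forall>i<k. c i \<in> pverts G) \<and> can_force G l k Q [] c (pverts G))"

text \<open>The parameters usually written \<open>c\<^sub>l(G)\<close> and \<open>c'\<^sub>l(G)\<close>:\<close>

definition cop_number :: "'a pair_pre_digraph \<Rightarrow> nat \<Rightarrow> nat" where
  "cop_number G l = (LEAST k. can_guarantee G l k (=))"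

definition sight_number :: "'a pair_pre_digraph \<Rightarrow> nat \<Rightarrow> nat" where
  "sight_number G l = (LEAST k. can_guarantee G l k (within_dist G l))"

text \<open>
  A single cop at \<open>x\<close>, using no observations but its own, can capture a robber who is at \<open>y\<close>, when
  it is the cop's turn and when it is the robber's turn. In the second case the cop looks once
  before the robber leaves \<open>y\<close>, and the play is over if \<open>x = y\<close>.
\<close>

definition captures_alone_cop_turn :: "'a pair_pre_digraph \<Rightarrow> nat \<Rightarrow> 'a \<Rightarrow> 'a \<Rightarrow> bool" where
  "captures_alone_cop_turn G l x y \<longleftrightarrow> can_force G l 1 (=) [] (\<lambda>_. x) {y}"

definition captures_alone_robber_turn :: "'a pair_pre_digraph \<Rightarrow> nat \<Rightarrow> 'a \<Rightarrow> 'a \<Rightarrow> bool" where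
  "captures_alone_robber_turn G l x y \<longleftrightarrow>
     x = y \<or>
     can_force G l 1 (=) [observe G l 1 (\<lambda>_. x) y] (\<lambda>_. x) {z. legal_move G y z}"

text \<open>The minima above are attained: one cop on each vertex always suffices.\<close>

lemma can_guarantee_card:
  assumes "finite (pverts G)" and "\<And>x. x \<in> pverts G \<Longrightarrow> Q x x"
  shows "can_guarantee G l (card (pverts G)) Q"
proof -
  let ?n = "card (pverts G)"
  obtain c where c: "bij_betw c {0..<?n} (pverts G)"
    using ex_bij_betw_nat_finite[OF assms(1)] by blast
  have in_V: "c i \<in> pverts G" if "i < ?n" for i
    using c that by (auto simp: bij_betw_def)
  have "can_force G l ?n Q [] c (pverts G)"
    unfolding can_force_def Let_def
  proof (intro exI[of _ "\<lambda>_. c"] allI impI)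
    fix R assume R: "robber_walk G R \<and> R 0 \<in> pverts G"
    then obtain i where "i < ?n" "c i = R 0"
      using c unfolding bij_betw_def by (metis atLeastLessThan_iff imageE)
    moreover have const: "cops_at G l ?n (\<lambda>_. c) [] c R t = c" for t
      by (cases t) simp_all
    ultimately show "(\<forall>t. \<forall>i<?n. legal_move G (cops_at G l ?n (\<lambda>_. c) [] c R t i)
          (cops_at G l ?n (\<lambda>_. c) [] c R (Suc t) i)) \<and>
        (\<exists>t. \<exists>i<?n. Q (cops_at G l ?n (\<lambda>_. c) [] c R t i) (R t) \<or>
          Q (cops_at G l ?n (\<lambda>_. c) [] c R (Suc t) i) (R t))"
      using R in_V assms(2) unfolding const legal_move_def by metis
  qed
  then show ?thesis
    using in_V unfolding can_guarantee_def by blast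
qed

end

theory Submission
  imports Defs
begin

text \<open>
  A cop who has the robber in sight follows the robber's trail, keeping a geodesic to the robber and
  switching to a shorter one whenever the trail ceases to be a geodesic. After each of the cop's
  moves the robber is within distance \<open>l\<close>, so the cop knows the trail; if the robber then escapes
  to distance \<open>l + 1\<close>, the trail extended by that move is still a geodesic, and the cop's next step
  along it does not depend on where the robber went. The length of the geodesic never increases.
  If the robber were never caught, it would be eventually constant and at least 2, and the cop's
  positions would form an infinite walk in which vertices two steps apart are distinct and not
  adjacent. In a chordal graph such a walk is an induced path: a closest pair of repeated or adjacent
  positions would close up an induced cycle of length at least 4. This contradicts finiteness.
  For \<open>l = 0\<close>, seeing the robber is capturing it.
\<close>

section \<open>Walks and geodesics\<close>

text \<open>Vertex lists turn a round into list operations: the robber appends a vertex, the cop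
  drops the head. \<open>length\<close> counts vertices, one more than the number of steps.\<close>

definition walk_between :: "'a pair_pre_digraph \<Rightarrow> 'a \<Rightarrow> 'a list \<Rightarrow> 'a \<Rightarrow> bool" where
  "walk_between G x p y \<longleftrightarrow>
     p \<noteq> [] \<and> hd p = x \<and> last p = y \<and> set p \<subseteq> pverts G \<and>
     successively (\<lambda>u v. (u, v) \<in> parcs G) p"

definition geodesic :: "'a pair_pre_digraph \<Rightarrow> 'a \<Rightarrow> 'a list \<Rightarrow> 'a \<Rightarrow> bool" where
  "geodesic G x p y \<longleftrightarrow>
     walk_between G x p y \<and> (\<forall>q. walk_between G x q y \<longrightarrow> length p \<le> length q)"

lemma geodesic_imp_walk: "geodesic G x p y \<Longrightarrow> walk_between G x p y"
  by (simp add: geodesic_def)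

lemma geodesic_length_le: "geodesic G x p y \<Longrightarrow> walk_between G x q y \<Longrightarrow> length p \<le> length q"
  by (simp add: geodesic_def)

lemma walk_between_tl:
  assumes "walk_between G x p y" and "tl p \<noteq> []"
  shows "walk_between G (hd (tl p)) (tl p) y"
  using assms by (cases p) (auto simp: walk_between_def successively_Cons)

lemma walk_between_snoc:
  assumes "walk_between G x p y" and "(y, z) \<in> parcs G" and "z \<in> pverts G"
  shows "walk_between G x (p @ [z]) z"
  using assms by (auto simp: walk_between_def successively_append_iff)

lemma ex_geodesic:
  assumes "walk_between G x q y"
  shows "\<exists>p. geodesic G x p y"
  using assms ex_has_least_nat[of "\<lambda>p. walk_between G x p y" q length]
  unfolding geodesic_def by blast

text \<open>Otherwise \<open>v\<close> could be cut out of the geodesic. The cop's track inherits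
  this local condition.\<close>

lemma geodesic_skip:
  assumes "geodesic G x (u # v # w # p) y"
  shows "u \<noteq> w" and "(u, w) \<notin> parcs G"
proof -
  have walk: "walk_between G x (u # v # w # p) y"
    using assms by (rule geodesic_imp_walk)
  show "u \<noteq> w"
  proof
    assume "u = w"
    with walk have "walk_between G x (w # p) y"
      by (auto simp: walk_between_def)
    from geodesic_length_le[OF assms this] show False by simp
  qed
  show "(u, w) \<notin> parcs G"
  proof
    assume "(u, w) \<in> parcs G"
    with walk have "walk_between G x (u # w # p) y"
      by (auto simp: walk_between_def)
    from geodesic_length_le[OF assms this] show False by simp
  qed
qed

lemma (in pair_wf_digraph) awalk_imp_walk_between:
  assumes "awalk x es y"
  shows "\<exists>p. walk_between G x p y \<and> length p = Suc (length es)"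
  using assms
proof (induction es arbitrary: x)
  case Nil
  then show ?case
    by (intro exI[of _ "[x]"]) (auto simp: awalk_Nil_iff walk_between_def)
next
  case (Cons e es)
  then have e: "e \<in> parcs G" "fst e = x" and "awalk (snd e) es y"
    by (auto simp: awalk_Cons_iff)
  with Cons.IH obtain p where p: "walk_between G (snd e) p y" "length p = Suc (length es)"
    by blast
  have "walk_between G x (x # p) y"
    using e p(1) in_arcsD1[of x "snd e"] by (cases e) (auto simp: walk_between_def successively_Cons)
  with p(2) show ?case by (intro exI[of _ "x # p"]) simp
qed

lemma (in pair_wf_digraph) walk_between_imp_awalk:
  assumes "walk_between G x p y"
  shows "\<exists>es. awalk x es y \<and> length p = Suc (length es)"
  using assms
proof (induction p arbitrary: x)
  case Nil
  then show ?case by (simp add: walk_between_def)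
next
  case (Cons u p)
  show ?case
  proof (cases "p = []")
    case True
    with Cons.prems show ?thesis
      by (intro exI[of _ "[]"]) (auto simp: awalk_Nil_iff walk_between_def)
  next
    case False
    with Cons.prems have "walk_between G (hd p) p y"
      using walk_between_tl[of G x "u # p" y] by simp
    with Cons.IH obtain es where es: "awalk (hd p) es y" "length p = Suc (length es)"
      by blast
    have "awalk x ((x, hd p) # es) y"
      using es(1) Cons.prems False
      by (auto simp: awalk_Cons_iff walk_between_def successively_Cons)
    with es(2) show ?thesis by (intro exI[of _ "(x, hd p) # es"]) simp
  qed
qed

lemma (in pair_wf_digraph) within_dist_iff_walk:
  "within_dist G n x y \<longleftrightarrow> (\<exists>p. walk_between G x p y \<and> length p \<le> Suc n)"
proof -
  have cost: "awalk_cost (\<lambda>_. 1) es = real (length es)" for es :: "('a \<times> 'a) list"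
    by (induction es) auto
  have "within_dist G n x y \<longleftrightarrow> (\<exists>es. awalk x es y \<and> length es \<le> n)"
  proof
    assume "within_dist G n x y"
    \<comment> \<open>\<open>\<mu>\<close> is an infimum over walks: a strict bound
      \<open>n + 1\<close> yields an actual walk, and integrality of its length lowers the bound to
      \<open>n\<close>.\<close>
    then have "\<mu> (\<lambda>_. 1) x y < ereal (real n + 1)"
      unfolding within_dist_def by (rule order_le_less_trans) simp
    then obtain es where "awalk x es y" "ereal (real (length es)) < ereal (real n + 1)"
      unfolding \<mu>_def INF_less_iff cost by blast
    then show "\<exists>es. awalk x es y \<and> length es \<le> n" by (intro exI[of _ es]) auto
  next
    assume "\<exists>es. awalk x es y \<and> length es \<le> n"
    then obtain es where es: "awalk x es y" "length es \<le> n" by blast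
    have "\<mu> (\<lambda>_. 1) x y \<le> ereal (real (length es))"
      using min_cost_le_walk_cost[OF es(1), of "\<lambda>_. 1"] by (simp add: cost)
    also have "\<dots> \<le> ereal (real n)" using es(2) by simp
    finally show "within_dist G n x y" unfolding within_dist_def .
  qed
  then show ?thesis
    using awalk_imp_walk_between walk_between_imp_awalk by (metis Suc_le_mono)
qed

lemma (in pair_wf_digraph) within_dist_refl: "x \<in> pverts G \<Longrightarrow> within_dist G n x x"
  unfolding within_dist_iff_walk by (intro exI[of _ "[x]"]) (simp add: walk_between_def)

lemma (in pair_wf_digraph) within_dist_0_imp_eq:
  assumes "within_dist G 0 x y"
  shows "x = y"
proof -
  obtain p where "walk_between G x p y" "length p \<le> Suc 0"
    using assms unfolding within_dist_iff_walk by blast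
  then show ?thesis by (cases p) (auto simp: walk_between_def)
qed

section \<open>Locally induced walks in chordal graphs\<close>

text \<open>Induction on \<open>b - a\<close> reduces to a shortest violation. A repetition would
  make \<open>w (b - 1)\<close> a neighbour of \<open>w a\<close>, a shorter violation; a chord
  would close up an induced cycle on \<open>b - a + 1\<close> vertices, at least 4.\<close>

lemma (in pair_graph) locally_induced_walk_is_induced:
  fixes w :: "nat \<Rightarrow> 'a"
  assumes "chordal G"
    and step: "\<And>t. (w t, w (Suc t)) \<in> parcs G"
    and skip: "\<And>t. w t \<noteq> w (t + 2)" "\<And>t. (w t, w (t + 2)) \<notin> parcs G"
  shows "a + 2 \<le> b \<Longrightarrow> w a \<noteq> w b \<and> (w a, w b) \<notin> parcs G"
proof (induction "b - a" arbitrary: a b rule: less_induct)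
  case less
  have IH: "w c \<noteq> w d" "(w c, w d) \<notin> parcs G" if "a \<le> c" "c + 2 \<le> d" "d \<le> b" "(c, d) \<noteq> (a, b)" for c d
  proof -
    have "d - c < b - a" using that less.prems by auto
    then show "w c \<noteq> w d" "(w c, w d) \<notin> parcs G" using less.hyps[of d c] that by auto
  qed
  show ?case
  proof (cases "b = a + 2")
    case True
    then show ?thesis using skip by simp
  next
    case False
    with less.prems have b: "a + 3 \<le> b" by simp
    have neq: "w c \<noteq> w d" if "a \<le> c" "c < d" "d \<le> b" "(c, d) \<noteq> (a, b)" for c d
      using IH(1)[of c d] that no_loops'[OF step[of c]] by (cases "d = Suc c") auto
    have ne: "w a \<noteq> w b"
    proof
      assume "w a = w b"
      moreover have "(w (b - 1), w b) \<in> parcs G" using step[of "b - 1"] b by simp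
      ultimately have "(w a, w (b - 1)) \<in> parcs G" using arcs_symmetric by simp
      with IH(2)[of a "b - 1"] b show False by simp
    qed
    have "(w a, w b) \<notin> parcs G"
    proof
      assume chord: "(w a, w b) \<in> parcs G"
      define vs where "vs = map w [a..<Suc b]"
      have len: "length vs = Suc (b - a)" using b by (simp add: vs_def)
      have nth: "vs ! i = w (a + i)" if "i \<le> b - a" for i
        using that b by (simp add: vs_def nth_append del: upt_Suc)
      have inj: "inj_on w {a..b}"
      proof (rule linorder_inj_onI)
        fix c d assume "c < d" "c \<in> {a..b}" "d \<in> {a..b}"
        then show "w c \<noteq> w d" using neq[of c d] ne by (cases "(c, d) = (a, b)") auto
      qed auto
      \<comment> \<open>Shorter gaps are covered by \<open>IH\<close>, so the closing chord is the
        only adjacency between non-consecutive indices.\<close>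
      have fwd: "(w (a + i), w (a + j)) \<in> parcs G \<longleftrightarrow> j = Suc i \<or> i = 0 \<and> j = b - a"
        if "i < j" "j \<le> b - a" for i j
      proof (cases "j = Suc i")
        case True
        then show ?thesis using step[of "a + i"] by simp
      next
        case False
        then show ?thesis
          using that b chord IH(2)[of "a + i" "a + j"] by (cases "(a + i, a + j) = (a, b)") auto
      qed
      have arcs: "(vs ! i, vs ! j) \<in> parcs G \<longleftrightarrow>
          j = Suc i mod length vs \<or> i = Suc j mod length vs"
        if "i < length vs" "j < length vs" for i j
      proof -
        have md: "Suc m mod length vs = (if m = b - a then 0 else Suc m)" if "m \<le> b - a" for m
          using that by (simp add: len)
        have ij: "i \<le> b - a" "j \<le> b - a" using that len by auto
        consider "i < j" | "i = j" | "j < i" by linarith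
        then show ?thesis
        proof cases
          case 1
          then show ?thesis using fwd[of i j] ij b by (auto simp: nth md)
        next
          case 2
          then show ?thesis using ij b no_loops' by (auto simp: nth md)
        next
          case 3
          have "(w (a + i), w (a + j)) \<in> parcs G \<longleftrightarrow> (w (a + j), w (a + i)) \<in> parcs G"
            using arcs_symmetric by blast
          with 3 show ?thesis using fwd[of j i] ij b by (auto simp: nth md)
        qed
      qed
      have "distinct vs"
        unfolding vs_def distinct_map using inj by (simp add: atLeastLessThanSuc_atLeastAtMost del: upt_Suc)
      moreover have "set vs \<subseteq> pverts G"
        using in_arcsD1[OF step] by (auto simp: vs_def)
      ultimately have "induced_cycle G vs"
        using arcs len b unfolding induced_cycle_def by auto
      with \<open>chordal G\<close> show False
        using len b unfolding chordal_def by auto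
    qed
    with ne show ?thesis by blast
  qed
qed

lemma (in pair_graph) no_infinite_locally_induced_walk:
  fixes w :: "nat \<Rightarrow> 'a"
  assumes "chordal G"
    and step: "\<And>t. (w t, w (Suc t)) \<in> parcs G"
    and skip: "\<And>t. w t \<noteq> w (t + 2)" "\<And>t. (w t, w (t + 2)) \<notin> parcs G"
  shows False
proof -
  have "inj w"
  proof (rule linorder_injI)
    fix c d :: nat assume "c < d"
    then show "w c \<noteq> w d"
      using locally_induced_walk_is_induced[OF assms, of c d] no_loops'[OF step[of c]]
      by (cases "d = Suc c") auto
  qed
  moreover have "range w \<subseteq> pverts G"
    using in_arcsD1[OF step] by auto
  ultimately show False
    using pair_finite_verts finite_subset finite_imageD infinite_UNIV_nat by metis
qed

section \<open>The pursuit\<close>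

text \<open>
  The state of a pursuit is a walk from the cop to the vertex where the robber was last known to be;
  the robber has since moved to \<open>r\<close>.
\<close>

definition extend_geodesic :: "'a pair_pre_digraph \<Rightarrow> 'a list \<Rightarrow> 'a \<Rightarrow> 'a list" where
  "extend_geodesic G q r =
     (if geodesic G (hd q) (q @ [r]) r then q @ [r] else SOME p. geodesic G (hd q) p r)"

text \<open>A one-vertex geodesic means that the cop already stands at \<open>r\<close>. Keeping it
  avoids the empty list, so \<open>hd\<close> always gives the cop's position.\<close>

definition advance :: "'a pair_pre_digraph \<Rightarrow> 'a list \<Rightarrow> 'a \<Rightarrow> 'a list" where
  "advance G q r =
     (let p = extend_geodesic G q r in if tl p = [] then p else tl p)"

primrec pursuit :: "'a pair_pre_digraph \<Rightarrow> 'a list \<Rightarrow> (nat \<Rightarrow> 'a) \<Rightarrow> nat \<Rightarrow> 'a list" where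
  "pursuit G q R 0 = q"
| "pursuit G q R (Suc t) = advance G (pursuit G q R t) (R t)"

text \<open>Because of this, positions read off from past observations can replace the true robber
  in the cop's computation.\<close>

lemma pursuit_cong:
  "(\<And>s. s < t \<Longrightarrow> R s = R' s) \<Longrightarrow> pursuit G q R t = pursuit G q R' t"
  by (induction t) simp_all

section \<open>One round of the pursuit\<close>

context pair_wf_digraph
begin

lemma legal_move_in_verts: "legal_move G u v \<Longrightarrow> v \<in> pverts G"
  using in_arcsD2 by (auto simp: legal_move_def)

lemma walk_between_legal_move:
  assumes "walk_between G x q y" and "legal_move G y r"
  obtains p where "walk_between G x p r" and "p = q \<or> p = q @ [r]"
  using assms walk_between_snoc[of G x q y r] legal_move_in_verts[OF assms(2)]
  unfolding legal_move_def by (cases "r = y") fastforce+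

lemma geodesic_extend:
  assumes "walk_between G x q y" and "legal_move G y r"
  shows "geodesic G x (extend_geodesic G q r) r"
proof -
  have "hd q = x" using assms(1) by (simp add: walk_between_def)
  moreover obtain p where "geodesic G x p r"
    using walk_between_legal_move[OF assms] ex_geodesic by metis
  ultimately show ?thesis
    unfolding extend_geodesic_def by (auto intro: someI)
qed

lemma extend_geodesic_length:
  assumes "walk_between G x q y" and "legal_move G y r"
  shows "length (extend_geodesic G q r) \<le> Suc (length q)"
proof -
  obtain p where "walk_between G x p r" "p = q \<or> p = q @ [r]"
    by (rule walk_between_legal_move[OF assms])
  then show ?thesis
    using geodesic_length_le[OF geodesic_extend[OF assms]] by fastforce
qed

text \<open>The robber cannot have stayed put, as \<open>q\<close> itself would then be too short;
  hence \<open>q @ [r]\<close> is a walk of least possible length, and it is preferred to all other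
  geodesics.\<close>

lemma extend_geodesic_eq:
  assumes "walk_between G x q y" and "legal_move G y r"
    and "\<And>p. walk_between G x p r \<Longrightarrow> length q < length p"
  shows "extend_geodesic G q r = q @ [r]"
proof -
  obtain p where p: "walk_between G x p r" "p = q \<or> p = q @ [r]"
    using walk_between_legal_move[OF assms(1,2)] by metis
  with assms(3) have "walk_between G x (q @ [r]) r" by auto
  with assms(3) have "geodesic G x (q @ [r]) r"
    by (auto simp: geodesic_def Suc_le_eq)
  moreover have "hd q = x" using assms(1) by (simp add: walk_between_def)
  ultimately show ?thesis by (simp add: extend_geodesic_def)
qed

lemma advance_walk:
  assumes "walk_between G x q y" and "legal_move G y r"
  shows "walk_between G (hd (advance G q r)) (advance G q r) r"
    and "legal_move G x (hd (advance G q r))"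
proof -
  let ?p = "extend_geodesic G q r"
  have p: "walk_between G x ?p r"
    using geodesic_extend[OF assms] by (rule geodesic_imp_walk)
  then show "walk_between G (hd (advance G q r)) (advance G q r) r"
    using walk_between_tl[OF p] by (auto simp: advance_def Let_def walk_between_def)
  show "legal_move G x (hd (advance G q r))"
    using p by (cases ?p rule: remdups_adj.cases)
      (auto simp: advance_def walk_between_def legal_move_def)
qed

lemma advance_length:
  assumes "walk_between G x q y" and "legal_move G y r"
  shows "length (advance G q r) \<le> max 1 (length q)"
  using extend_geodesic_length[OF assms]
  by (cases "extend_geodesic G q r" rule: remdups_adj.cases) (auto simp: advance_def)

text \<open>Out of sight means that every walk to \<open>r\<close> has more than
  \<open>l + 1\<close> vertices, so the geodesic is \<open>q @ [r]\<close>, whose second vertex does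
  not depend on \<open>r\<close>.\<close>

lemma hd_advance_unseen:
  assumes "walk_between G x q y" and "legal_move G y r"
    and "length q \<le> Suc l" and "1 \<le> l" and unseen: "\<not> within_dist G l x r"
  shows "hd (advance G q r) = q ! 1"
proof -
  have longer: "length q < length p" if "walk_between G x p r" for p
    using that unseen assms(3) unfolding within_dist_iff_walk by fastforce
  obtain p where "walk_between G x p r" "p = q \<or> p = q @ [r]"
    by (rule walk_between_legal_move[OF assms(1,2)])
  \<comment> \<open>With a one-vertex \<open>q\<close> the robber would be at most one step away,
    hence in sight as \<open>1 \<le> l\<close>.\<close>
  then have "2 \<le> length q"
    using unseen \<open>1 \<le> l\<close> unfolding within_dist_iff_walk by fastforce
  then show ?thesis
    using extend_geodesic_eq[OF assms(1,2) longer]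
    by (cases q rule: remdups_adj.cases) (auto simp: advance_def)
qed

end

section \<open>The pursuit over all rounds\<close>

context pair_graph
begin

text \<open>The robber's move adds at most one vertex and the cop's move removes one, so the cop
  regains sight in every round. The \<open>case\<close> expression is the end of the walk, one move
  behind the robber.\<close>

lemma pursuit_walk:
  assumes "walk_between G x q y" and "length q \<le> Suc l"
    and "legal_move G y (R 0)" and "robber_walk G R"
  shows "walk_between G (hd (pursuit G q R t)) (pursuit G q R t) (case t of 0 \<Rightarrow> y | Suc s \<Rightarrow> R s)
    \<and> length (pursuit G q R t) \<le> Suc l"
proof (induction t)
  case 0
  then show ?case using assms(1,2) by (auto simp: walk_between_def)
next
  case (Suc t)
  have "legal_move G (case t of 0 \<Rightarrow> y | Suc s \<Rightarrow> R s) (R t)"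
    using assms(3,4) by (auto simp: robber_walk_def split: nat.split)
  then show ?case
    using Suc advance_walk(1) advance_length by fastforce
qed

text \<open>
  As long as the robber is not captured, the length of the geodesic cannot increase. Once it is
  constant, every geodesic arises from the previous one by dropping its first vertex and appending
  the robber's position, so three consecutive cop positions start a geodesic.
\<close>

lemma pursuit_captures:
  assumes "chordal G" and "walk_between G x q y"
    and "legal_move G y (R 0)" and "robber_walk G R"
  shows "\<exists>t. hd (pursuit G q R t) = R t \<or> hd (pursuit G q R (Suc t)) = R t"
proof (rule ccontr)
  assume "\<not> ?thesis"
  then have free: "hd (pursuit G q R t) \<noteq> R t" "hd (pursuit G q R (Suc t)) \<noteq> R t" for t
    by auto
  define C where "C t = hd (pursuit G q R t)" for t
  define E where "E t = extend_geodesic G (pursuit G q R t) (R t)" for t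
  define R' where "R' t = (case t of 0 \<Rightarrow> y | Suc s \<Rightarrow> R s)" for t
  have legal: "legal_move G (R' t) (R t)" for t
    using assms(3,4) by (auto simp: R'_def robber_walk_def split: nat.split)
  have walk: "walk_between G (C t) (pursuit G q R t) (R' t)" for t
    using pursuit_walk[OF assms(2) _ assms(3,4), of "length q"] by (simp add: C_def R'_def)
  have geo: "geodesic G (C t) (E t) (R t)" for t
    unfolding E_def by (rule geodesic_extend[OF walk legal])
  have next_def: "pursuit G q R (Suc t) = (if tl (E t) = [] then E t else tl (E t))" for t
    by (simp add: advance_def E_def Let_def)
  \<comment> \<open>With one vertex in \<open>E t\<close> the cop would already stand at
    \<open>R t\<close>, with two its next step would land there.\<close>
  have long: "\<exists>u v p. E t = C t # u # v # p" for t
  proof -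
    have "walk_between G (C t) (E t) (R t)" using geo by (rule geodesic_imp_walk)
    then show ?thesis
      using free[of t] next_def[of t]
      by (cases "E t" rule: remdups_adj.cases; cases "tl (tl (E t))")
        (auto simp: walk_between_def C_def)
  qed
  have pursuit_Suc: "pursuit G q R (Suc t) = tl (E t)" for t
    using long[of t] next_def[of t] by auto
  have "length (E (Suc t)) \<le> length (E t)" for t
  proof -
    have "length (E (Suc t)) \<le> Suc (length (pursuit G q R (Suc t)))"
      unfolding E_def by (rule extend_geodesic_length[OF walk legal])
    also have "\<dots> = length (E t)"
      using long[of t] by (auto simp: pursuit_Suc simp del: pursuit.simps)
    finally show ?thesis .
  qed
  then have "decseq (\<lambda>t. length (E t))" by (rule decseq_SucI)
  then have anti: "length (E t') \<le> length (E t)" if "t \<le> t'" for t t'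
    using that by (rule decseqD)
  \<comment> \<open>At \<open>t0\<close> the length is least; being non-increasing, it is constant
    from there on.\<close>
  obtain t0 where min: "\<And>t. length (E t0) \<le> length (E t)"
    using ex_has_least_nat[of "\<lambda>_. True" 0 "\<lambda>t. length (E t)"] by blast
  have const: "length (E t) = length (E t0)" if "t0 \<le> t" for t
    using anti[OF that] min[of t] by simp
  have shift: "E (Suc t) = tl (E t) @ [R (Suc t)]" if "t0 \<le> t" for t
  proof -
    \<comment> \<open>\<open>E (Suc t)\<close> is as long as \<open>E t\<close>, which has one
      vertex more than its tail, the current walk.\<close>
    have longer: "length (pursuit G q R (Suc t)) < length p"
      if "walk_between G (C (Suc t)) p (R (Suc t))" for p
      using geodesic_length_le[OF geo that] const[OF \<open>t0 \<le> t\<close>] const[of "Suc t"] \<open>t0 \<le> t\<close> long[of t]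
      by (auto simp: pursuit_Suc simp del: pursuit.simps)
    have "extend_geodesic G (pursuit G q R (Suc t)) (R (Suc t)) = pursuit G q R (Suc t) @ [R (Suc t)]"
      by (rule extend_geodesic_eq[OF walk legal]) (rule longer)
    then show ?thesis unfolding E_def[of "Suc t"] pursuit_Suc .
  qed
  define w where "w s = C (t0 + s)" for s
  have local: "(w s, w (Suc s)) \<in> parcs G \<and> w s \<noteq> w (s + 2) \<and> (w s, w (s + 2)) \<notin> parcs G" for s
  proof -
    obtain u v p where E: "E (t0 + s) = w s # u # v # p"
      using long[of "t0 + s"] by (auto simp: w_def)
    have "C (Suc t) = hd (tl (E t))" for t
      by (simp only: C_def pursuit_Suc)
    \<comment> \<open>The next step leads to \<open>u\<close>; by \<open>shift\<close> the new
      geodesic then starts with \<open>u\<close>, \<open>v\<close>, so \<open>v\<close>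
      follows.\<close>
    then have uv: "w (Suc s) = u" "w (s + 2) = v"
      using E shift[of "t0 + s"] by (simp_all add: w_def)
    have g: "geodesic G (C (t0 + s)) (w s # u # v # p) (R (t0 + s))"
      using geo[of "t0 + s"] by (simp add: E)
    have "(w s, u) \<in> parcs G"
      using geodesic_imp_walk[OF g] unfolding walk_between_def by auto
    with geodesic_skip[OF g] show ?thesis unfolding uv by blast
  qed
  show False
    using no_infinite_locally_induced_walk[OF assms(1), of w] local by blast
qed

end

section \<open>Strategies\<close>

lemma length_history: "length (history G l k \<sigma> h c R t) = length h + 2 * t + 1"
  by (induction t) (simp_all add: Let_def)

lemma history_nth_after_cops:
  "s < t \<Longrightarrow> history G l k \<sigma> h c R t ! (length h + 2 * s + 1)
     = observe G l k (cops_at G l k \<sigma> h c R (Suc s)) (R s)"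
  by (induction t) (auto simp: Let_def nth_append length_history less_Suc_eq)

lemma last_history:
  "last (history G l k \<sigma> h c R t) = observe G l k (cops_at G l k \<sigma> h c R t) (R t)"
  by (cases t) (simp_all add: Let_def)

text \<open>A choice that depends only on \<open>h\<close> and the first observation is therefore
  never revised later.\<close>

lemma history_prefix: "\<exists>X. history G l k \<sigma> h c R t = h @ observe G l k c (R 0) # X"
  by (induction t) (auto simp: Let_def)

lemma observe_cases: "observe G l k c r = None \<or> observe G l k c r = Some r"
  by (simp add: observe_def)

text \<open>
  Cop \<open>i\<close> follows the pursuit while the others stay at \<open>c\<close>. After \<open>m\<close> earlier observations, the
  entry \<open>m + 2 * s + 1\<close> of the list \<open>H\<close> is the one made after the cops' move in round \<open>s + 1\<close>;
  the pursuing cop always sees the robber then. An unseen last move of the robber leaves the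
  next step unaffected.
\<close>

definition pursuit_strategy ::
  "'a pair_pre_digraph \<Rightarrow> nat \<Rightarrow> (nat \<Rightarrow> 'a) \<Rightarrow> nat \<Rightarrow> 'a list \<Rightarrow> 'a option list \<Rightarrow> nat \<Rightarrow> 'a" where
  "pursuit_strategy G m c i q H =
     (let p = pursuit G q (\<lambda>s. the (H ! (m + 2 * s + 1))) ((length H - m - 1) div 2)
      in c(i := (case last H of None \<Rightarrow> p ! 1 | Some r \<Rightarrow> hd (advance G p r))))"

section \<open>Playing the pursuit with limited visibility\<close>

context pair_graph
begin

text \<open>Strong induction: the cop saw the robber after each of its earlier moves, which recovers
  all of \<open>R\<close> but the last position. That one is either seen or, by
  \<open>hd_advance_unseen\<close>, irrelevant to the next step.\<close>

lemma cops_at_pursuit_strategy: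
  assumes "1 \<le> l" and "i < k"
    and q: "walk_between G (c i) q y" "length q \<le> Suc l"
    and R: "legal_move G y (R 0)" "robber_walk G R"
  shows "cops_at G l k (pursuit_strategy G (length h) c i q) h c R t = c(i := hd (pursuit G q R t))"
proof (induction t rule: less_induct)
  case (less t)
  show ?case
  proof (cases t)
    case 0
    then show ?thesis using q by (simp add: walk_between_def)
  next
    case (Suc u)
    let ?C = "cops_at G l k (pursuit_strategy G (length h) c i q) h c R"
    let ?H = "history G l k (pursuit_strategy G (length h) c i q) h c R u"
    have "the (?H ! (length h + 2 * s + 1)) = R s" if "s < u" for s
    proof -
      have "?C (Suc s) i = hd (pursuit G q R (Suc s))"
        using less[of "Suc s"] that Suc by simp
      moreover have "within_dist G l (hd (pursuit G q R (Suc s))) (R s)"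
        using pursuit_walk[of _ _ _ l R "Suc s", OF q R] unfolding within_dist_iff_walk by auto
      ultimately have "observe G l k (?C (Suc s)) (R s) = Some (R s)"
        using \<open>i < k\<close> unfolding observe_def by metis
      then show ?thesis by (simp only: history_nth_after_cops[OF that] option.sel)
    qed
    then have p: "pursuit G q (\<lambda>s. the (?H ! (length h + 2 * s + 1))) u = pursuit G q R u"
      by (rule pursuit_cong)
    have last: "last ?H = observe G l k (?C u) (R u)"
      by (rule last_history)
    have "(case last ?H of None \<Rightarrow> pursuit G q R u ! 1 | Some r \<Rightarrow> hd (advance G (pursuit G q R u) r))
        = hd (pursuit G q R (Suc u))"
    proof (cases "last ?H")
      case None
      then have "\<not> within_dist G l (hd (pursuit G q R u)) (R u)"
        using less[of u] Suc \<open>i < k\<close> unfolding last observe_def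
        by (metis fun_upd_same lessI option.distinct(1))
      moreover have "legal_move G (case u of 0 \<Rightarrow> y | Suc s \<Rightarrow> R s) (R u)"
        using R by (auto simp: robber_walk_def split: nat.split)
      ultimately show ?thesis
        using hd_advance_unseen[OF _ _ _ \<open>1 \<le> l\<close>] pursuit_walk[OF q R, of u] None by auto
    next
      case (Some r)
      then have "r = R u" using observe_cases[of G l k "?C u" "R u"] unfolding last by auto
      with Some show ?thesis by simp
    qed
    moreover have "(length ?H - length h - 1) div 2 = u"
      by (simp add: length_history)
    ultimately have "pursuit_strategy G (length h) c i q ?H = c(i := hd (pursuit G q R (Suc u)))"
      by (simp only: pursuit_strategy_def[of G "length h" c i q ?H] Let_def p)
    then show ?thesis by (simp add: Suc)
  qed
qed

text \<open>The chase reads only entries made after \<open>h\<close>, so it can start in the middle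
  of any longer play.\<close>

lemma can_force_capture_if_seen:
  assumes "chordal G" and "1 \<le> l" and "i < k"
    and "\<And>j. j < k \<Longrightarrow> c j \<in> pverts G"
    and "within_dist G l (c i) y"
  shows "can_force G l k (=) h c {z. legal_move G y z}"
proof -
  obtain q where q: "walk_between G (c i) q y" "length q \<le> Suc l"
    using assms(5) unfolding within_dist_iff_walk by blast
  show ?thesis
    unfolding can_force_def Let_def
  proof (intro exI[of _ "pursuit_strategy G (length h) c i q"] allI impI)
    fix R assume "robber_walk G R \<and> R 0 \<in> {z. legal_move G y z}"
    then have R: "legal_move G y (R 0)" "robber_walk G R" by auto
    let ?C = "cops_at G l k (pursuit_strategy G (length h) c i q) h c R"
    have C: "?C t = c(i := hd (pursuit G q R t))" for t
      by (rule cops_at_pursuit_strategy[where y = y]) (use assms q R in auto)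
    have "legal_move G (hd (pursuit G q R t)) (hd (pursuit G q R (Suc t)))" for t
    proof -
      have "legal_move G (case t of 0 \<Rightarrow> y | Suc s \<Rightarrow> R s) (R t)"
        using R by (auto simp: robber_walk_def split: nat.split)
      then show ?thesis using advance_walk(2) pursuit_walk[OF q R, of t] by auto
    qed
    then have "\<forall>t. \<forall>j<k. legal_move G (?C t j) (?C (Suc t) j)"
      using assms(4) unfolding C by (auto simp: legal_move_def)
    moreover have "\<exists>t. ?C t i = R t \<or> ?C (Suc t) i = R t"
      using pursuit_captures[OF assms(1) q(1) R] unfolding C by simp
    ultimately show "(\<forall>t. \<forall>j<k. legal_move G (?C t j) (?C (Suc t) j)) \<and>
        (\<exists>t. \<exists>j<k. ?C t j = R t \<or> ?C (Suc t) j = R t)"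
      using \<open>i < k\<close> by blast
  qed
qed

text \<open>The cops follow the sighting strategy until the first sighting, then switch to the
  chase. The rest of the play is a game with the cops' current positions and with the earlier
  observations as initial history.\<close>

lemma can_guarantee_capture_if_sight:
  assumes "chordal G" and "1 \<le> l" and "can_guarantee G l k (within_dist G l)"
  shows "can_guarantee G l k (=)"
proof -
  obtain c \<sigma> where c: "\<And>i. i < k \<Longrightarrow> c i \<in> pverts G"
    and \<sigma>: "\<And>R. robber_walk G R \<Longrightarrow> R 0 \<in> pverts G \<Longrightarrow>
      (\<forall>t. \<forall>i<k. legal_move G (cops_at G l k \<sigma> [] c R t i) (cops_at G l k \<sigma> [] c R (Suc t) i)) \<and>
      (\<exists>t. \<exists>i<k. within_dist G l (cops_at G l k \<sigma> [] c R t i) (R t) \<or>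
         within_dist G l (cops_at G l k \<sigma> [] c R (Suc t) i) (R t))"
    using assms(3) unfolding can_guarantee_def can_force_def Let_def by blast
  define good where "good h c' y \<tau> \<longleftrightarrow> (\<forall>R. robber_walk G R \<and> legal_move G y (R 0) \<longrightarrow>
      (\<forall>t. \<forall>i<k. legal_move G (cops_at G l k \<tau> h c' R t i) (cops_at G l k \<tau> h c' R (Suc t) i)) \<and>
      (\<exists>t. \<exists>i<k. cops_at G l k \<tau> h c' R t i = R t \<or> cops_at G l k \<tau> h c' R (Suc t) i = R t))"
    for h c' y \<tau>
  \<comment> \<open>Fixing the choice as a function of the data at the switch makes all later rounds
    use the same chase.\<close>
  define \<tau> where "\<tau> h c' y = (SOME \<tau>. good h c' y \<tau>)" for h c' y
  have \<tau>: "good h c' y (\<tau> h c' y)"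
    if "\<And>j. j < k \<Longrightarrow> c' j \<in> pverts G" "\<exists>i<k. within_dist G l (c' i) y" for h c' y
  proof -
    have "can_force G l k (=) h c' {z. legal_move G y z}"
      using can_force_capture_if_seen[OF assms(1,2)] that by blast
    then have "\<exists>\<tau>. good h c' y \<tau>"
      unfolding can_force_def Let_def good_def by simp
    then show ?thesis unfolding \<tau>_def by (rule someI_ex)
  qed
  \<comment> \<open>The first sighting, at index \<open>n\<close> of the history, happens when the cops have made \<open>T\<close> moves;
    they then stand at \<open>\<sigma> (take (2 * T - 1) H)\<close>.\<close>
  define \<rho> where "\<rho> H = (if set H \<subseteq> {None} then \<sigma> H else
     (let n = length (takeWhile (\<lambda>z. z = None) H); T = (n + 1) div 2
      in \<tau> (take (2 * T) H) (if T = 0 then c else \<sigma> (take (2 * T - 1) H)) (the (H ! n)) H))"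
    for H :: "'a option list"
  have "can_force G l k (=) [] c (pverts G)"
    unfolding can_force_def Let_def
  proof (intro exI[of _ \<rho>] allI impI)
    fix R assume "robber_walk G R \<and> R 0 \<in> pverts G"
    then have R: "robber_walk G R" "R 0 \<in> pverts G" by auto
    define C where "C = cops_at G l k \<sigma> [] c R"
    define H where "H = history G l k \<sigma> [] c R"
    define C' where "C' = cops_at G l k \<rho> [] c R"
    define H' where "H' = history G l k \<rho> [] c R"
    note simps = C_def H_def C'_def H'_def Let_def
    \<comment> \<open>With the cops at \<open>C t\<close>, a sighting can occur after the robber's
      move to \<open>R t\<close> or just before it.\<close>
    define seen where "seen t \<longleftrightarrow> (\<exists>i<k. within_dist G l (C t i) (R t)) \<or>
      (\<exists>s. t = Suc s \<and> (\<exists>i<k. within_dist G l (C t i) (R s)))" for t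
    define T where "T = (LEAST t. seen t)"
    have legal: "legal_move G (C t i) (C (Suc t) i)" if "i < k" for t i
      using \<sigma>[OF R] that unfolding C_def by blast
    have "\<exists>t. seen t"
      using \<sigma>[OF R] unfolding C_def[symmetric] seen_def by blast
    then have seen_T: "seen T" unfolding T_def by (rule LeastI_ex)
    have unseen: "\<not> seen t" if "t < T" for t
      using that unfolding T_def by (rule not_less_Least)
    have None: "set (H t) \<subseteq> {None}" if "t < T" for t
      using that
    proof (induction t)
      case 0
      then show ?case using unseen[of 0] by (auto simp: seen_def observe_def simps)
    next
      case (Suc t)
      then show ?case using unseen[of "Suc t"] by (auto simp: seen_def observe_def simps)
    qed
    have H': "H' t = H t" if "t < T" for t
      using that
    proof (induction t)
      case 0
      then show ?case by (simp add: simps)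
    next
      case (Suc t)
      then have "H' t = H t" "\<rho> (H t) = \<sigma> (H t)"
        using None[of t] by (simp_all add: \<rho>_def)
      then show ?case by (simp add: simps)
    qed
    have C': "C' t = C t" if "t \<le> T" for t
    proof (cases t)
      case (Suc s)
      then have "H' s = H s" "\<rho> (H s) = \<sigma> (H s)"
        using H'[of s] None[of s] that by (simp_all add: \<rho>_def)
      with Suc show ?thesis by (simp add: simps)
    qed (simp add: simps)
    define h where "h = (case T of 0 \<Rightarrow> [] | Suc s \<Rightarrow> H s @ [observe G l k (C T) (R s)])"
    \<comment> \<open>The robber's vertex at the sighting; in every case \<open>R T\<close> is a
      legal move from it, so the chase starts with the robber at \<open>R T\<close>.\<close>
    define y where "y = (case T of 0 \<Rightarrow> R T | Suc s \<Rightarrow>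
      if \<exists>i<k. within_dist G l (C T i) (R s) then R s else R T)"
    let ?\<tau> = "\<tau> h (C T) y"
    \<comment> \<open>The first entry other than \<open>None\<close> has index \<open>2 * T\<close>
      or, if the robber is seen before moving, \<open>2 * T - 1\<close>;
      \<open>(n + 1) div 2\<close> is \<open>T\<close> in both cases.\<close>
    have \<rho>: "\<rho> (h @ observe G l k (C T) (R T) # X) = ?\<tau> (h @ observe G l k (C T) (R T) # X)" for X
    proof (cases T)
      case 0
      with seen_T have "observe G l k c (R 0) = Some (R 0)"
        by (auto simp: seen_def observe_def C_def)
      with 0 show ?thesis by (simp add: \<rho>_def h_def y_def C_def)
    next
      case (Suc s)
      have len: "length (H s) = 2 * s + 1" by (simp add: H_def length_history)
      have tw: "takeWhile (\<lambda>z. z = None) (H s @ xs) = H s @ takeWhile (\<lambda>z. z = None) xs" for xs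
        by (rule takeWhile_append2) (use None[of s] Suc in auto)
      have Csuc: "C (Suc s) = \<sigma> (H s)" by (simp add: C_def H_def)
      show ?thesis
      proof (cases "\<exists>i<k. within_dist G l (C T i) (R s)")
        case True
        then have "observe G l k (C T) (R s) = Some (R s)" by (simp add: observe_def)
        with True Suc show ?thesis
          by (simp add: \<rho>_def h_def y_def tw len nth_append Csuc)
      next
        case False
        then have unobserved: "observe G l k (C T) (R s) = None" by (simp add: observe_def)
        from False seen_T Suc have "observe G l k (C T) (R T) = Some (R T)"
          by (auto simp: seen_def observe_def)
        moreover have "y = R T"
          unfolding y_def Suc using False unfolding Suc by auto
        ultimately show ?thesis
          using unobserved Suc by (simp add: \<rho>_def h_def tw len nth_append Csuc)
      qed
    qed
    let ?R = "\<lambda>s. R (T + s)"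
    have H'_T: "H' T = h @ [observe G l k (C T) (R T)]"
    proof (cases T)
      case 0
      then show ?thesis by (simp add: h_def simps)
    next
      case (Suc s)
      then have "H' T = H' s @ [observe G l k (C' T) (R s), observe G l k (C' T) (R T)]"
        by (simp add: simps)
      then show ?thesis using Suc H'[of s] C'[of T] by (simp add: h_def)
    qed
    \<comment> \<open>From \<open>T\<close> on, the play under \<open>\<rho>\<close> is the chase
      with its clock reset to 0.\<close>
    have shift_H: "H' (T + s) = history G l k ?\<tau> h (C T) ?R s" for s
    proof (induction s)
      case 0
      then show ?case by (simp add: H'_T)
    next
      case (Suc s)
      have "\<rho> (H' (T + s)) = ?\<tau> (H' (T + s))"
        using history_prefix[of G l k ?\<tau> h "C T" ?R s] \<rho> by (auto simp: Suc)
      then show ?case using Suc by (simp add: H'_def Let_def)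
    qed
    have shift_C: "C' (T + s) = cops_at G l k ?\<tau> h (C T) ?R s" for s
    proof (cases s)
      case 0
      then show ?thesis by (simp add: C')
    next
      case (Suc s')
      have "C' (T + s) = \<rho> (H' (T + s'))"
        using Suc by (simp add: C'_def H'_def)
      also have "\<dots> = ?\<tau> (H' (T + s'))"
        using history_prefix[of G l k ?\<tau> h "C T" ?R s'] \<rho> by (auto simp: shift_H)
      finally show ?thesis using Suc shift_H by simp
    qed
    have "C T j \<in> pverts G" if "j < k" for j
      using legal[OF that] by (auto simp: legal_move_def)
    moreover have "\<exists>i<k. within_dist G l (C T i) y"
      using seen_T by (auto simp: y_def seen_def split: nat.split)
    ultimately have "good h (C T) y ?\<tau>" by (rule \<tau>)
    moreover have "robber_walk G ?R"
      using R(1) by (simp add: robber_walk_def)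
    moreover have "legal_move G y (?R 0)"
      using R(1) by (auto simp: y_def robber_walk_def legal_move_def split: nat.split)
    ultimately have "(\<forall>s. \<forall>i<k. legal_move G (C' (T + s) i) (C' (T + Suc s) i)) \<and>
        (\<exists>s. \<exists>i<k. C' (T + s) i = ?R s \<or> C' (T + Suc s) i = ?R s)"
      unfolding good_def shift_C by blast
    then have chase: "\<And>s i. i < k \<Longrightarrow> legal_move G (C' (T + s) i) (C' (Suc (T + s)) i)"
        "\<exists>s. \<exists>i<k. C' (T + s) i = R (T + s) \<or> C' (Suc (T + s)) i = R (T + s)"
      by auto
    have "legal_move G (C' t i) (C' (Suc t) i)" if "i < k" for t i
    proof (cases "t < T")
      case True
      then show ?thesis using legal[OF that] C' by simp
    next
      case False
      then show ?thesis using chase(1)[OF that, of "t - T"] by simp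
    qed
    with chase(2) show "(\<forall>t. \<forall>i<k. legal_move G (cops_at G l k \<rho> [] c R t i)
          (cops_at G l k \<rho> [] c R (Suc t) i)) \<and>
        (\<exists>t. \<exists>i<k. cops_at G l k \<rho> [] c R t i = R t \<or> cops_at G l k \<rho> [] c R (Suc t) i = R t)"
      unfolding C'_def[symmetric] by blast
  qed
  then show ?thesis using c unfolding can_guarantee_def by blast
qed

end

section \<open>Comparison of the two parameters and capture by one cop\<close>

lemma can_guarantee_mono:
  assumes "can_guarantee G l k Q" and "\<And>x y. x \<in> pverts G \<Longrightarrow> Q x y \<Longrightarrow> Q' x y"
  shows "can_guarantee G l k Q'"
proof -
  obtain c \<sigma> where c: "\<And>i. i < k \<Longrightarrow> c i \<in> pverts G"
    and \<sigma>: "\<And>R. robber_walk G R \<Longrightarrow> R 0 \<in> pverts G \<Longrightarrow>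
      (\<forall>t. \<forall>i<k. legal_move G (cops_at G l k \<sigma> [] c R t i) (cops_at G l k \<sigma> [] c R (Suc t) i)) \<and>
      (\<exists>t. \<exists>i<k. Q (cops_at G l k \<sigma> [] c R t i) (R t) \<or> Q (cops_at G l k \<sigma> [] c R (Suc t) i) (R t))"
    using assms(1) unfolding can_guarantee_def can_force_def Let_def by blast
  have "can_force G l k Q' [] c (pverts G)"
    unfolding can_force_def Let_def
  proof (intro exI[of _ \<sigma>] allI impI)
    fix R assume R: "robber_walk G R \<and> R 0 \<in> pverts G"
    let ?C = "cops_at G l k \<sigma> [] c R"
    from R \<sigma> have legal: "\<forall>t. \<forall>i<k. legal_move G (?C t i) (?C (Suc t) i)"
      and Q: "\<exists>t. \<exists>i<k. Q (?C t i) (R t) \<or> Q (?C (Suc t) i) (R t)"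
      by blast+
    from legal have "?C t i \<in> pverts G" if "i < k" for t i
      using that unfolding legal_move_def by blast
    with Q have "\<exists>t. \<exists>i<k. Q' (?C t i) (R t) \<or> Q' (?C (Suc t) i) (R t)"
      using assms(2) by meson
    with legal show "(\<forall>t. \<forall>i<k. legal_move G (?C t i) (?C (Suc t) i)) \<and>
        (\<exists>t. \<exists>i<k. Q' (?C t i) (R t) \<or> Q' (?C (Suc t) i) (R t))"
      by blast
  qed
  then show ?thesis using c unfolding can_guarantee_def by blast
qed

lemma can_force_subset: "can_force G l k Q h c S \<Longrightarrow> S' \<subseteq> S \<Longrightarrow> can_force G l k Q h c S'"
  unfolding can_force_def Let_def by (erule ex_forward) (simp add: subset_iff)

lemma captures_alone_cop_turn_same:
  assumes "x \<in> pverts G"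
  shows "captures_alone_cop_turn G l x x"
proof -
  have const: "cops_at G l (Suc 0) (\<lambda>_ _. x) [] (\<lambda>_. x) R t = (\<lambda>_. x)" for R t
    by (cases t) simp_all
  have "legal_move G x x" using assms by (simp add: legal_move_def)
  then show ?thesis
    unfolding captures_alone_cop_turn_def can_force_def Let_def One_nat_def
    by (intro exI[of _ "\<lambda>_ _. x"] allI impI, unfold const) blast
qed

theorem theorem4p2:
  fixes G :: "'a pair_pre_digraph" and l :: nat
  assumes "pair_graph G"
    and "Digraph_Component.connected (with_proj G)"
    and "chordal G"
  shows "sight_number G l = cop_number G l \<and>
    (\<forall>x \<in> pverts G. \<forall>y \<in> pverts G. within_dist G l x y \<longrightarrow>
       captures_alone_cop_turn G l x y \<and> captures_alone_robber_turn G l x y)"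
proof -
  interpret pair_graph G by (rule assms(1))
  have "can_guarantee G l k (within_dist G l) \<longleftrightarrow> can_guarantee G l k (=)" for k
  proof
    assume sight: "can_guarantee G l k (within_dist G l)"
    show "can_guarantee G l k (=)"
    proof (cases "l = 0")
      case True
      show ?thesis
        using sight by (rule can_guarantee_mono) (use True within_dist_0_imp_eq in blast)
    next
      case False
      then show ?thesis
        using can_guarantee_capture_if_sight[OF assms(3) _ sight] by simp
    qed
  next
    assume "can_guarantee G l k (=)"
    then show "can_guarantee G l k (within_dist G l)"
      by (rule can_guarantee_mono) (simp add: within_dist_refl)
  qed
  then have "sight_number G l = cop_number G l"
    unfolding sight_number_def cop_number_def by simp
  moreover have "captures_alone_cop_turn G l x y \<and> captures_alone_robber_turn G l x y"
    if xy: "x \<in> pverts G" "y \<in> pverts G" "within_dist G l x y" for x y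
  proof (cases "l = 0")
    case True
    with xy within_dist_0_imp_eq have "x = y" by blast
    then show ?thesis
      using captures_alone_cop_turn_same[OF xy(1)] by (simp add: captures_alone_robber_turn_def)
  next
    \<comment> \<open>\<open>h\<close> is left arbitrary to cover both the empty history and the
      single look before the robber moves.\<close>
    case False
    then have force: "can_force G l 1 (=) h (\<lambda>_. x) {z. legal_move G y z}" for h
      using can_force_capture_if_seen[OF assms(3), of l 0 1 "\<lambda>_. x" y h] xy by simp
    \<comment> \<open>On the cop's turn, the robber at \<open>y\<close> counts as having just stayed
      put.\<close>
    have sub: "{y} \<subseteq> {z. legal_move G y z}"
      using xy(2) by (simp add: legal_move_def)
    show ?thesis
      unfolding captures_alone_cop_turn_def captures_alone_robber_turn_def
      using can_force_subset[OF force sub] force by blast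
  qed
  ultimately show ?thesis by blast
qed

end
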